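(* Let $\mathcal{A}_1,\mathcal{A}_2,\mathcal{A}_3$ be non-empty sets and let $l_3:\mathcal{A}_1\times\mathcal{A}_2\times\mathcal{A}_3\to\mathbb{R}$, $(a_1,a_2,a_3)\mapsto l_3(a_1,a_2,a_3)$, be a function. Then the following inequalities hold: $$\sup_{a_2\in \mathcal{A}_2}\ \inf_{a_1\in \mathcal{A}_1,\,a_3\in \mathcal{A}_3}l_3(a_1,a_2,a_3)\ \leq\ \inf_{a_3\in \mathcal{A}_3}\ \sup_{a_2\in \mathcal{A}_2}\ \inf_{a_1\in \mathcal{A}_1}l_3(a_1,a_2,a_3)\ \leq\ \inf_{a_1\in \mathcal{A}_1,\,a_3\in \mathcal{A}_3}\ \sup_{a_2\in \mathcal{A}_2}l_3(a_1,a_2,a_3),$$ and similarly $$\sup_{a_1\in \mathcal{A}_1,\,a_3\in \mathcal{A}_3}\ \inf_{a_2\in \mathcal{A}_2}l_3(a_1,a_2,a_3)\ \leq\ \sup_{a_3\in \mathcal{A}_3}\ \inf_{a_2\in \mathcal{A}_2}\ \sup_{a_1\in \mathcal{A}_1}l_3(a_1,a_2,a_3)\ \leq\ \inf_{a_2\in \mathcal{A}_2}\ \sup_{a_1\in \mathcal{A}_1,\,a_3\in \mathcal{A}_3}l_3(a_1,a_2,a_3).$$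
   Context: Suprema and infima are taken in the extended real line $[-\infty,+\infty]$. The domains are uncoupled, i.e. each variable $a_i$ ranges over its own set $\mathcal{A}_i$ independently of the others; a supremum (infimum) subscripted by two variables is taken jointly over the product set. *)

theory Defs
  imports "HOL-Library.Extended_Real"
begin

end

theory Submission
  imports Defs
begin

text \<open>
  Both chains come from one fact: a supremum of infima lies below the infimum of the corresponding
  suprema (lemma \<open>SUP_INF_le_INF_SUP\<close>). A joint infimum over \<open>A1 \<times> A3\<close> is an iterated one, with
  \<open>a3\<close> outermost, so the three members of the first chain are
  \<open>sup\<^sub>2 inf\<^sub>3 inf\<^sub>1 \<le> inf\<^sub>3 sup\<^sub>2 inf\<^sub>1 \<le> inf\<^sub>3 inf\<^sub>1 sup\<^sub>2\<close>: moving \<open>sup\<^sub>2\<close> one place to the right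
  exchanges it with a single infimum and can only increase the value. The second chain is
  \<open>sup\<^sub>3 sup\<^sub>1 inf\<^sub>2 \<le> sup\<^sub>3 inf\<^sub>2 sup\<^sub>1 \<le> inf\<^sub>2 sup\<^sub>3 sup\<^sub>1\<close>, where \<open>inf\<^sub>2\<close> moves to the left.
\<close>

text \<open>
  Weak duality: for fixed \<open>x\<close> and \<open>y\<close>, the value \<open>f x y\<close> separates the infimum over the second
  argument from the supremum over the first.
\<close>

lemma SUP_INF_le_INF_SUP:
  fixes f :: "'a \<Rightarrow> 'b \<Rightarrow> 'c::complete_lattice"
  shows "(SUP x\<in>A. INF y\<in>B. f x y) \<le> (INF y\<in>B. SUP x\<in>A. f x y)"
  by (intro SUP_least INF_greatest order_trans[OF INF_lower SUP_upper])

lemma INF_Times_swap: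
  fixes f :: "'a \<Rightarrow> 'b \<Rightarrow> 'c::complete_lattice"
  shows "(INF (x, y)\<in>A \<times> B. f x y) = (INF y\<in>B. INF x\<in>A. f x y)"
proof (rule antisym)
  show "(INF (x, y)\<in>A \<times> B. f x y) \<le> (INF y\<in>B. INF x\<in>A. f x y)"
  proof (intro INF_greatest)
    fix x y assume "y \<in> B" "x \<in> A"
    then show "(INF (x, y)\<in>A \<times> B. f x y) \<le> f x y"
      by (intro INF_lower2[of "(x, y)"]) auto
  qed
  show "(INF y\<in>B. INF x\<in>A. f x y) \<le> (INF (x, y)\<in>A \<times> B. f x y)"
    by (rule INF_greatest) (auto intro!: INF_lower2 INF_lower)
qed

lemma SUP_Times_swap:
  fixes f :: "'a \<Rightarrow> 'b \<Rightarrow> 'c::complete_lattice"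
  shows "(SUP (x, y)\<in>A \<times> B. f x y) = (SUP y\<in>B. SUP x\<in>A. f x y)"
proof (rule antisym)
  show "(SUP (x, y)\<in>A \<times> B. f x y) \<le> (SUP y\<in>B. SUP x\<in>A. f x y)"
    by (rule SUP_least) (auto intro!: SUP_upper2 SUP_upper)
  show "(SUP y\<in>B. SUP x\<in>A. f x y) \<le> (SUP (x, y)\<in>A \<times> B. f x y)"
  proof (intro SUP_least)
    fix x y assume "y \<in> B" "x \<in> A"
    then show "f x y \<le> (SUP (x, y)\<in>A \<times> B. f x y)"
      by (intro SUP_upper2[of "(x, y)"]) auto
  qed
qed

theorem proposition1:
  fixes A1 :: "'a set" and A2 :: "'b set" and A3 :: "'c set"
    and l3 :: "'a \<times> 'b \<times> 'c \<Rightarrow> real"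
  assumes "A1 \<noteq> {}" and "A2 \<noteq> {}" and "A3 \<noteq> {}"
  shows "(SUP a2\<in>A2. INF (a1, a3)\<in>A1 \<times> A3. ereal (l3 (a1, a2, a3)))
           \<le> (INF a3\<in>A3. SUP a2\<in>A2. INF a1\<in>A1. ereal (l3 (a1, a2, a3)))
         \<and> (INF a3\<in>A3. SUP a2\<in>A2. INF a1\<in>A1. ereal (l3 (a1, a2, a3)))
           \<le> (INF (a1, a3)\<in>A1 \<times> A3. SUP a2\<in>A2. ereal (l3 (a1, a2, a3)))
         \<and> (SUP (a1, a3)\<in>A1 \<times> A3. INF a2\<in>A2. ereal (l3 (a1, a2, a3)))
           \<le> (SUP a3\<in>A3. INF a2\<in>A2. SUP a1\<in>A1. ereal (l3 (a1, a2, a3)))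
         \<and> (SUP a3\<in>A3. INF a2\<in>A2. SUP a1\<in>A1. ereal (l3 (a1, a2, a3)))
           \<le> (INF a2\<in>A2. SUP (a1, a3)\<in>A1 \<times> A3. ereal (l3 (a1, a2, a3)))"
  unfolding INF_Times_swap SUP_Times_swap
  by (intro conjI)
    (rule SUP_INF_le_INF_SUP INF_mono'[OF SUP_INF_le_INF_SUP] SUP_mono'[OF SUP_INF_le_INF_SUP])+

end
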